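(* Let $F$ be a field with $\operatorname{char}(F)\neq 2,3$, let $K/F$ be a quadratic étale extension with non-trivial Galois automorphism $\sigma$, and denote the norm and trace of this extension by $\operatorname{Nr}$ and $\operatorname{Tr}$, respectively. Let $\mathcal{J}=(J,N,\sharp,T,1)$ be a cubic norm structure over $K$, let $\varphi\in\operatorname{Str}(\mathcal{J})$ be a $\sigma$-semilinear self-adjoint autotopy of $\mathcal{J}$, put $\delta:=N(\varphi(1))$, and let $\gamma\in K$ be such that $\gamma^{\sigma+1}=\delta^{-1}$. Let $\mathcal{A}=K\oplus J$ be the structurable $F$-algebra of skew-dimension one with involution $\overline{(s,b)}:=(s^\sigma,b)$ and multiplication $$(s,b)(t,c):=\bigl(st+T(b,\varphi(c)),\; sc+t^\sigma b+\gamma\,(\varphi(b)\times\varphi(c))\bigr)$$ for $s,t\in K$, $b,c\in J$. Then the norm $\nu$ of $\mathcal{A}$ is given by $$\nu(s,b)=\bigl(\operatorname{Nr}(s)-T(b,\varphi(b))\bigr)^2-4\,T(b^\sharp,\varphi(b)^\sharp)+4\operatorname{Tr}\bigl(\gamma^{-1}sN(b)\bigr)$$ for all $(s,b)\in\mathcal{A}$.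
   Context: **Conventions.** A quadratic étale extension $K/F$ is either a separable quadratic field extension or the split algebra $F\oplus F$ (with $\sigma$ the exchange map). For $t\in K$ write $t^\sigma=\sigma(t)$, $t^{\sigma+1}=t^\sigma t$; $\operatorname{Nr}(t)=tt^\sigma$, $\operatorname{Tr}(t)=t+t^\sigma$. **Cubic norm structure.** A cubic norm structure over a commutative associative $F$-algebra $K$ is a quintuple $\mathcal{J}=(J,N,\sharp,T,1)$, where $J$ is a left $K$-module, $N\colon J\to K$, $\sharp\colon J\to J$, $a\mapsto a^\sharp$, are maps, $T\colon J\times J\to K$ is a symmetric $K$-bilinear form and $1\in J\setminus\{0\}$, such that with $a\times b:=(a+b)^\sharp-a^\sharp-b^\sharp$, for all $t\in K$, $a,b\in J$: (i) $(ta)^\sharp=t^2a^\sharp$; (ii) $N(ta)=t^3N(a)$; (iii) $N(a+b)=N(a)+T(b,a^\sharp)+T(a,b^\sharp)+N(b)$; (iv) $a^{\sharp\sharp}=N(a)a$; (v) $1^\sharp=1$; (vi) $b=T(b,1)1-1\times b$. Put $U_a(b):=T(a,b)a-a^\sharp\times b$ for $a,b\in J$. An element $a\in J$ is invertible if $N(a)$ is invertible in $K$. **Autotopies.** For invertible $z\in J$, put $a^{\sharp_z}:=N(z)^{-1}U_z(a^\sharp)$. A map $\varphi\colon J\to J$ is $\sigma$-semilinear if it is additive and $\varphi(ta)=t^\sigma\varphi(a)$. A $\sigma$-semilinear bijection $\varphi\colon J\to J$ such that $z:=\varphi(1)$ is invertible is an autotopy of $\mathcal{J}$ if $\varphi(a^\sharp)=\varphi(a)^{\sharp_z}$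 for all $a\in J$. $\operatorname{Str}(\mathcal{J})$ is the group of all autotopies (over all $\sigma\in\operatorname{Aut}(K)$). The adjoint of $\varphi$ is $\check\varphi:=\varphi^{-1}U_z$, and $\varphi$ is self-adjoint if $\check\varphi=\varphi$. **Norm of a structurable algebra of skew-dimension one.** Let $\mathcal{A}$ be a structurable $F$-algebra with involution $x\mapsto\overline{x}$ and with one-dimensional space $\mathcal{S}=\{x:\overline{x}=-x\}$ of skew elements. Fix any non-zero $s_0\in\mathcal{S}$ and let $\mu\in F^\times$ be such that $s_0^2=\mu\cdot 1$ (such $\mu$ exists for the algebras considered here). For $x,y\in\mathcal{A}$ put $U_x(y):=2(x\overline{y})x-(x\overline{x})y$ and $\psi(x,y):=x\overline{y}-y\overline{x}\in\mathcal{S}$. The norm of $\mathcal{A}$ is the map $\nu\colon\mathcal{A}\to F$ given by $$\nu(x)=\tfrac{1}{6\mu}\,\psi\bigl(x,U_x(s_0x)\bigr)\,s_0\in F\cdot 1=F ,$$ which does not depend on the choice of $s_0$. *)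

theory Defs
  imports
    "HOL-Computational_Algebra.Computational_Algebra"
    "HOL-Library.Product_Plus"
begin

definition unital_ring_hom :: "('a::comm_ring_1 \<Rightarrow> 'b::comm_ring_1) \<Rightarrow> bool" where
  "unital_ring_hom h \<longleftrightarrow>
     h 1 = 1 \<and> (\<forall>x y. h (x + y) = h x + h y) \<and> (\<forall>x y. h (x * y) = h x * h y)"

definition ring_aut :: "('a::comm_ring_1 \<Rightarrow> 'a) \<Rightarrow> bool" where
  "ring_aut h \<longleftrightarrow> unital_ring_hom h \<and> bij h"

text \<open>
  The type \<open>'k\<close> is only assumed to be a commutative ring, because it may be a product of two
  fields; hence inverses of units have to be defined. The value is meaningful on units only.
\<close>

definition unit_inv :: "'k::comm_ring_1 \<Rightarrow> 'k" where
  "unit_inv x = (THE y. x * y = 1)"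

text \<open>
  An \<open>F\<close>-algebra \<open>K\<close> is given by its structure homomorphism \<open>\<iota>\<close>. Since \<open>dim\<close> is 0 on
  infinite-dimensional spaces, \<open>dim = 2\<close> says that \<open>K/F\<close> is finite of degree 2.
\<close>

definition separable_quadratic_field_ext ::
    "('f::field \<Rightarrow> 'k::comm_ring_1) \<Rightarrow> ('k \<Rightarrow> 'k) \<Rightarrow> bool" where
  "separable_quadratic_field_ext \<iota> \<sigma> \<longleftrightarrow>
     unital_ring_hom \<iota> \<and>
     (\<forall>x::'k. x \<noteq> 0 \<longrightarrow> x dvd 1) \<and>
     vector_space.dim (\<lambda>a x. \<iota> a * x) (UNIV :: 'k set) = 2 \<and>
     (\<forall>x::'k. \<exists>p::'f poly. coprime p (pderiv p) \<and> p \<noteq> 0 \<and> poly (map_poly \<iota> p) x = 0) \<and>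
     ring_aut \<sigma> \<and> (\<forall>a. \<sigma> (\<iota> a) = \<iota> a) \<and> \<sigma> \<noteq> id"

text \<open>
  Here \<open>x \<mapsto> (p x, q x)\<close> is an isomorphism of \<open>F\<close>-algebras from \<open>K\<close> onto \<open>F \<oplus> F\<close> that transports
  \<open>\<sigma>\<close> to the exchange map.
\<close>

definition split_quadratic_algebra ::
    "('f::field \<Rightarrow> 'k::comm_ring_1) \<Rightarrow> ('k \<Rightarrow> 'k) \<Rightarrow> bool" where
  "split_quadratic_algebra \<iota> \<sigma> \<longleftrightarrow>
     unital_ring_hom \<iota> \<and>
     (\<exists>p q :: 'k \<Rightarrow> 'f.
        unital_ring_hom p \<and> unital_ring_hom q \<and>
        (\<forall>a. p (\<iota> a) = a \<and> q (\<iota> a) = a) \<and>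
        bij (\<lambda>x. (p x, q x)) \<and>
        (\<forall>x. p (\<sigma> x) = q x \<and> q (\<sigma> x) = p x))"

definition quadratic_etale :: "('f::field \<Rightarrow> 'k::comm_ring_1) \<Rightarrow> ('k \<Rightarrow> 'k) \<Rightarrow> bool" where
  "quadratic_etale \<iota> \<sigma> \<longleftrightarrow>
     separable_quadratic_field_ext \<iota> \<sigma> \<or> split_quadratic_algebra \<iota> \<sigma>"

definition Nr :: "('k::comm_ring_1 \<Rightarrow> 'k) \<Rightarrow> 'k \<Rightarrow> 'k" where
  "Nr \<sigma> t = t * \<sigma> t"

definition Tr :: "('k::comm_ring_1 \<Rightarrow> 'k) \<Rightarrow> 'k \<Rightarrow> 'k" where
  "Tr \<sigma> t = t + \<sigma> t"

definition cns_cross :: "('j::ab_group_add \<Rightarrow> 'j) \<Rightarrow> 'j \<Rightarrow> 'j \<Rightarrow> 'j" where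
  "cns_cross sharp a b = sharp (a + b) - sharp a - sharp b"

locale cubic_norm_structure = module scale
  for scale :: "'k::comm_ring_1 \<Rightarrow> 'j::ab_group_add \<Rightarrow> 'j" +
  fixes N :: "'j \<Rightarrow> 'k"
    and sharp :: "'j \<Rightarrow> 'j"
    and T :: "'j \<Rightarrow> 'j \<Rightarrow> 'k"
    and e :: 'j
  assumes T_linear: "module_hom scale (*) (\<lambda>a. T a b)"
    and T_sym: "T a b = T b a"
    and e_nonzero: "e \<noteq> 0"
    and sharp_scale: "sharp (scale t a) = scale (t ^ 2) (sharp a)"
    and N_scale: "N (scale t a) = t ^ 3 * N a"
    and N_add: "N (a + b) = N a + T b (sharp a) + T a (sharp b) + N b"
    and sharp_sharp: "sharp (sharp a) = scale (N a) a"
    and sharp_e: "sharp e = e"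
    and e_cross: "b = scale (T b e) e - cns_cross sharp e b"

definition cns_U ::
    "('k::comm_ring_1 \<Rightarrow> 'j::ab_group_add \<Rightarrow> 'j) \<Rightarrow> ('j \<Rightarrow> 'j) \<Rightarrow> ('j \<Rightarrow> 'j \<Rightarrow> 'k) \<Rightarrow>
     'j \<Rightarrow> 'j \<Rightarrow> 'j" where
  "cns_U scale sharp T a b = scale (T a b) a - cns_cross sharp (sharp a) b"

definition isotope_sharp ::
    "('k::comm_ring_1 \<Rightarrow> 'j::ab_group_add \<Rightarrow> 'j) \<Rightarrow> ('j \<Rightarrow> 'k) \<Rightarrow> ('j \<Rightarrow> 'j) \<Rightarrow>
     ('j \<Rightarrow> 'j \<Rightarrow> 'k) \<Rightarrow> 'j \<Rightarrow> 'j \<Rightarrow> 'j" where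
  "isotope_sharp scale N sharp T z a = scale (unit_inv (N z)) (cns_U scale sharp T z (sharp a))"

definition semilinear ::
    "('k::comm_ring_1 \<Rightarrow> 'j::ab_group_add \<Rightarrow> 'j) \<Rightarrow> ('k \<Rightarrow> 'k) \<Rightarrow> ('j \<Rightarrow> 'j) \<Rightarrow> bool" where
  "semilinear scale \<sigma> \<phi> \<longleftrightarrow>
     (\<forall>a b. \<phi> (a + b) = \<phi> a + \<phi> b) \<and> (\<forall>t a. \<phi> (scale t a) = scale (\<sigma> t) (\<phi> a))"

definition Str ::
    "('k::comm_ring_1 \<Rightarrow> 'j::ab_group_add \<Rightarrow> 'j) \<Rightarrow> ('j \<Rightarrow> 'k) \<Rightarrow> ('j \<Rightarrow> 'j) \<Rightarrow>
     ('j \<Rightarrow> 'j \<Rightarrow> 'k) \<Rightarrow> 'j \<Rightarrow> ('j \<Rightarrow> 'j) set" where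
  "Str scale N sharp T e =
     {\<phi>. (\<exists>\<tau>. ring_aut \<tau> \<and> semilinear scale \<tau> \<phi>) \<and> bij \<phi> \<and> N (\<phi> e) dvd 1 \<and>
         (\<forall>a. \<phi> (sharp a) = isotope_sharp scale N sharp T (\<phi> e) (\<phi> a))}"

definition adjoint_autotopy ::
    "('k::comm_ring_1 \<Rightarrow> 'j::ab_group_add \<Rightarrow> 'j) \<Rightarrow> ('j \<Rightarrow> 'j) \<Rightarrow> ('j \<Rightarrow> 'j \<Rightarrow> 'k) \<Rightarrow> 'j \<Rightarrow>
     ('j \<Rightarrow> 'j) \<Rightarrow> 'j \<Rightarrow> 'j" where
  "adjoint_autotopy scale sharp T e \<phi> = inv \<phi> \<circ> cns_U scale sharp T (\<phi> e)"

text \<open>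
  An algebra with involution is given by its scalar multiplication \<open>smul\<close>, unit \<open>u\<close>,
  multiplication \<open>mul\<close> and involution \<open>bar\<close>. The norm at \<open>x\<close> is the unique scalar \<open>v\<close> such that,
  for every choice of \<open>s\<^sub>0\<close>, the element \<open>v \<cdot> 1\<close> equals the defining expression. A unique such \<open>v\<close>
  exists only if there are non-zero skew elements, the squares of all of them are non-zero
  multiples of \<open>1\<close>, and the expression is a multiple of \<open>1\<close> that does not depend on \<open>s\<^sub>0\<close>; if this
  fails, \<open>THE\<close> gives an unspecified value.
\<close>

definition str_U ::
    "('f::field \<Rightarrow> 'a::ab_group_add \<Rightarrow> 'a) \<Rightarrow> ('a \<Rightarrow> 'a \<Rightarrow> 'a) \<Rightarrow> ('a \<Rightarrow> 'a) \<Rightarrow>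
     'a \<Rightarrow> 'a \<Rightarrow> 'a" where
  "str_U smul mul bar x y = smul 2 (mul (mul x (bar y)) x) - mul (mul x (bar x)) y"

definition str_psi :: "('a::ab_group_add \<Rightarrow> 'a \<Rightarrow> 'a) \<Rightarrow> ('a \<Rightarrow> 'a) \<Rightarrow> 'a \<Rightarrow> 'a \<Rightarrow> 'a" where
  "str_psi mul bar x y = mul x (bar y) - mul y (bar x)"

definition structurable_norm ::
    "('f::field \<Rightarrow> 'a::ab_group_add \<Rightarrow> 'a) \<Rightarrow> 'a \<Rightarrow> ('a \<Rightarrow> 'a \<Rightarrow> 'a) \<Rightarrow> ('a \<Rightarrow> 'a) \<Rightarrow>
     'a \<Rightarrow> 'f" where
  "structurable_norm smul u mul bar x =
     (THE v. \<forall>s\<^sub>0. s\<^sub>0 \<noteq> 0 \<and> bar s\<^sub>0 = - s\<^sub>0 \<longrightarrow>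
        (\<exists>\<mu>. \<mu> \<noteq> 0 \<and> mul s\<^sub>0 s\<^sub>0 = smul \<mu> u \<and>
             smul v u =
               smul (1 / (6 * \<mu>))
                 (mul (str_psi mul bar x (str_U smul mul bar x (mul s\<^sub>0 x))) s\<^sub>0)))"

definition KJ_smul ::
    "('f::field \<Rightarrow> 'k::comm_ring_1) \<Rightarrow> ('k \<Rightarrow> 'j::ab_group_add \<Rightarrow> 'j) \<Rightarrow>
     'f \<Rightarrow> 'k \<times> 'j \<Rightarrow> 'k \<times> 'j" where
  "KJ_smul \<iota> scale a = (\<lambda>(s, b). (\<iota> a * s, scale (\<iota> a) b))"

definition KJ_bar :: "('k::comm_ring_1 \<Rightarrow> 'k) \<Rightarrow> 'k \<times> 'j \<Rightarrow> 'k \<times> 'j" where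
  "KJ_bar \<sigma> = (\<lambda>(s, b). (\<sigma> s, b))"

definition KJ_mul ::
    "('k::comm_ring_1 \<Rightarrow> 'k) \<Rightarrow> ('k \<Rightarrow> 'j::ab_group_add \<Rightarrow> 'j) \<Rightarrow> ('j \<Rightarrow> 'j) \<Rightarrow>
     ('j \<Rightarrow> 'j \<Rightarrow> 'k) \<Rightarrow> ('j \<Rightarrow> 'j) \<Rightarrow> 'k \<Rightarrow> 'k \<times> 'j \<Rightarrow> 'k \<times> 'j \<Rightarrow> 'k \<times> 'j" where
  "KJ_mul \<sigma> scale sharp T \<phi> \<gamma> = (\<lambda>(s, b) (t, c).
     (s * t + T b (\<phi> c),
      scale s c + scale (\<sigma> t) b + scale \<gamma> (cns_cross sharp (\<phi> b) (\<phi> c))))"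

end

theory Submission
  imports Defs
begin

text \<open>
  Write \<open>x = (s, b)\<close>, \<open>n = Nr s\<close>, \<open>\<tau> = T(b, \<phi> b)\<close>, \<open>\<omega> = T(b\<^sup>\<sharp>, \<phi>(b)\<^sup>\<sharp>)\<close>,
  \<open>m = \<gamma>\<inverse> s N(b)\<close>. A skew element of \<open>K \<oplus> J\<close> is \<open>(k, 0)\<close> with \<open>\<sigma> k = - k\<close>. The
  formula results from a direct evaluation of \<open>\<psi>(x, U\<^sub>x((k, 0) x))\<close>, once three facts about
  \<open>\<phi>\<close> are known: it is a norm similarity, \<open>N(\<phi> a) = \<delta> \<sigma>(N a)\<close> (\<open>N_\<phi>\<close>); its
  polarization \<open>T(\<phi> b, \<phi>(a)\<^sup>\<sharp>) = \<delta> \<sigma>(T(b, a\<^sup>\<sharp>))\<close> (\<open>T_\<phi>_sharp_\<phi>\<close>); and the form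
  \<open>T(b, \<phi> c)\<close> is hermitian (\<open>T_\<phi>_hermitian\<close>).

  All three come from one identity. Self-adjointness says \<open>U\<^sub>z = \<phi> \<circ> \<phi>\<close> for \<open>z = \<phi>(1)\<close>, so the
  autotopy condition becomes \<open>\<phi>(\<phi>(a)\<^sup>\<sharp>) = \<delta> a\<^sup>\<sharp>\<close>. Applying this identity twice and
  comparing with \<open>a\<^sup>\<sharp>\<^sup>\<sharp> = N(a) a\<close> gives \<open>N_\<phi>\<close> up to cancelling \<open>a\<close>; polarizing \<open>N_\<phi>\<close> gives
  \<open>T_\<phi>_sharp_\<phi>\<close>; combining this with the identity gives hermitian symmetry against all
  \<open>c\<^sup>\<sharp>\<close>, and these elements span \<open>J\<close>.

  Hermitian symmetry shows that \<open>\<psi>(x, (t, c)) = (\<sigma> W - W, 0)\<close> with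
  \<open>W = t \<sigma>(s) + T(c, \<phi> b)\<close>. For \<open>(t, c) = U\<^sub>x((k, 0) x)\<close> the computation yields
  \<open>W = - 3 k ((n - \<tau>)\<^sup>2 - 4 \<omega> + 8 \<sigma>(m))\<close> (\<open>psi_arg\<close>). As \<open>\<tau>\<close> and \<open>\<omega>\<close> are fixed by
  \<open>\<sigma>\<close>, this makes \<open>\<psi>\<close> equal to \<open>6 k ((n - \<tau>)\<^sup>2 - 4 \<omega> + 4 Tr(m))\<close>, and multiplication
  by \<open>k\<close> and division by \<open>6 k\<^sup>2\<close> leave the asserted quartic form. This form is fixed by
  \<open>\<sigma>\<close>, hence it takes its values in \<open>F\<close>, and it does not involve \<open>k\<close>.

  The computation evaluates \<open>a \<times> b\<close> only under \<open>T\<close> or for \<open>b\<close> a multiple of \<open>a\<close>: the axioms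
  make \<open>T(c, a \<times> b)\<close> additive in each argument, but when \<open>T\<close> is degenerate
  they leave room for \<open>\<times>\<close> itself to fail to be additive.
\<close>

section \<open>Quadratic etale algebras\<close>

lemma unital_ring_homD:
  assumes "unital_ring_hom h"
  shows "h 1 = 1" "h (x + y) = h x + h y" "h (x * y) = h x * h y"
    "h 0 = 0" "h (- x) = - h x" "h (x - y) = h x - h y"
proof -
  show one: "h 1 = 1" and add: "h (x + y) = h x + h y" and "h (x * y) = h x * h y" for x y
    using assms by (auto simp: unital_ring_hom_def)
  show zero: "h 0 = 0" using add[of 0 0] by (metis add_left_imp_eq add_0_right)
  show minus: "h (- x) = - h x" for x
    using add[of x "- x"] zero by (metis add.right_inverse minus_unique)
  show "h (x - y) = h x - h y"
    using add[of x "- y"] minus by simp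
qed

text \<open>
  The features common to separable quadratic field extensions and to the split algebra. The last
  assumption is von Neumann regularity; it stands in for cancellation, which fails in the
  split algebra.
\<close>

locale etale_conjugation =
  fixes \<iota> :: "'f::field \<Rightarrow> 'k::comm_ring_1" and \<sigma> :: "'k \<Rightarrow> 'k"
  assumes \<iota>_hom: "unital_ring_hom \<iota>"
    and \<sigma>_hom: "unital_ring_hom \<sigma>"
    and \<sigma>_\<sigma> [simp]: "\<sigma> (\<sigma> x) = x"
    and fixed_in_range: "\<sigma> x = x \<Longrightarrow> x \<in> range \<iota>"
    and skew_exists: "\<exists>k. k \<noteq> 0 \<and> \<sigma> k = - k"
    and skew_square: "k \<noteq> 0 \<Longrightarrow> \<sigma> k = - k \<Longrightarrow> \<exists>\<mu>. \<mu> \<noteq> 0 \<and> k * k = \<iota> \<mu>"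
    and regular: "\<exists>y. x = x * x * y"
begin

lemmas \<iota>_simps [simp] = unital_ring_homD[OF \<iota>_hom]
lemmas \<sigma>_simps [simp] = unital_ring_homD[OF \<sigma>_hom]

lemma \<iota>_numeral [simp]: "\<iota> (numeral w) = numeral w"
  by (induction w) (simp_all only: numeral.simps \<iota>_simps)

lemma \<sigma>_numeral [simp]: "\<sigma> (numeral w) = numeral w"
  by (induction w) (simp_all only: numeral.simps \<sigma>_simps)

lemma \<sigma>_power [simp]: "\<sigma> (x ^ n) = \<sigma> x ^ n"
  by (induction n) simp_all

lemma \<iota>_inj: "\<iota> x = \<iota> y \<longleftrightarrow> x = y"
proof
  assume "\<iota> x = \<iota> y"
  then have *: "\<iota> (x - y) = 0"
    by simp
  show "x = y"
  proof (rule ccontr)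
    assume "x \<noteq> y"
    then have "\<iota> ((x - y) * inverse (x - y)) = \<iota> 1" by simp
    with * have "(1::'k) = 0" by (simp only: \<iota>_simps(1,3)) simp
    then have "k = 0" for k :: 'k by (metis mult.right_neutral mult_zero_right)
    with skew_exists show False by blast
  qed
qed simp

end

lemma field_ext_etale_conjugation:
  fixes \<iota> :: "'f::field \<Rightarrow> 'k::comm_ring_1"
  assumes "separable_quadratic_field_ext \<iota> \<sigma>"
  shows "etale_conjugation \<iota> \<sigma>"
proof -
  have \<iota>_hom: "unital_ring_hom \<iota>" and unit: "\<And>x::'k. x \<noteq> 0 \<Longrightarrow> x dvd 1"
    and dim: "vector_space.dim (\<lambda>a x. \<iota> a * x) UNIV = 2"
    and aut: "ring_aut \<sigma>" and \<sigma>_\<iota>: "\<sigma> (\<iota> a) = \<iota> a" and "\<sigma> \<noteq> id" for a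
    using assms by (simp_all add: separable_quadratic_field_ext_def)
  note \<iota> [simp] = unital_ring_homD[OF \<iota>_hom]
  note \<sigma> [simp] = unital_ring_homD[of \<sigma>, OF aut[unfolded ring_aut_def, THEN conjunct1]]
  have cancel: "x * y = 0 \<longleftrightarrow> x = 0 \<or> y = 0" for x y :: 'k
    by (metis dvd_def mult.left_commute mult.right_neutral mult_zero_left unit)
  interpret vector_space "\<lambda>a x. \<iota> a * x"
    by unfold_locales (simp_all add: algebra_simps)
  obtain B where B: "independent B" "UNIV \<subseteq> span B" "card B = 2"
    using basis_exists[of UNIV] dim by metis
  interpret finite_dimensional_vector_space "\<lambda>a x. \<iota> a * x" B
    using B by unfold_locales (auto intro: card_ge_0_finite)
  obtain \<theta> where \<theta>: "\<sigma> \<theta> \<noteq> \<theta>" using \<open>\<sigma> \<noteq> id\<close> by (metis eq_id_iff)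
  have \<theta>_notin: "\<theta> \<notin> span {1}"
    using \<theta> by (auto simp: span_singleton \<sigma>_\<iota>)
  have "(1::'k) \<noteq> 0" using \<theta>
    by (metis mult.right_neutral mult_zero_right)
  then have "independent {\<theta>, 1}"
    using \<theta>_notin by (simp add: independent_insert)
  moreover have "card {\<theta>, 1} = 2" using \<theta> by (cases "\<theta> = 1") auto
  ultimately have "UNIV \<subseteq> span {\<theta>, 1}"
    using dim by (intro card_ge_dim_independent) auto
  then have coords: "\<exists>p q. x = \<iota> p * \<theta> + \<iota> q" for x
  proof -
    have "x \<in> span {\<theta>, 1}" using \<open>UNIV \<subseteq> span {\<theta>, 1}\<close> by blast
    then obtain p q where "x - \<iota> p * \<theta> = \<iota> q"
      by (auto simp: span_insert span_singleton)
    then have "x = \<iota> p * \<theta> + \<iota> q" by (simp add: algebra_simps)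
    then show ?thesis by blast
  qed
  obtain p q where pq: "\<theta> * \<theta> = \<iota> p * \<theta> + \<iota> q" using coords by blast
  \<comment> \<open>Both \<open>\<theta>\<close> and \<open>\<sigma> \<theta>\<close> are roots of \<open>X\<^sup>2 - p X - q\<close>, so their sum is \<open>p\<close>.\<close>
  have "(\<sigma> \<theta> - \<theta>) * (\<sigma> \<theta> + \<theta> - \<iota> p) = 0"
  proof -
    have "\<sigma> \<theta> * \<sigma> \<theta> = \<iota> p * \<sigma> \<theta> + \<iota> q"
      using arg_cong[OF pq, of \<sigma>] by (simp add: \<sigma>_\<iota>)
    then show ?thesis using pq by (simp add: algebra_simps)
  qed
  then have conj: "\<sigma> \<theta> = \<iota> p - \<theta>"
    using \<theta> cancel by (metis diff_eq_eq eq_iff_diff_eq_0)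
  have \<sigma>\<sigma>: "\<sigma> (\<sigma> x) = x" for x
  proof -
    obtain a b where "x = \<iota> a * \<theta> + \<iota> b" using coords by blast
    then show ?thesis by (simp add: conj \<sigma>_\<iota>)
  qed
  have fixed: "x \<in> range \<iota>" if "\<sigma> x = x" for x
  proof -
    obtain a b where x: "x = \<iota> a * \<theta> + \<iota> b" using coords by blast
    then have "\<iota> a * (\<sigma> \<theta> - \<theta>) = 0" using that by (simp add: \<sigma>_\<iota> algebra_simps)
    then have "\<iota> a = 0" using \<theta> cancel by simp
    then show ?thesis using x by simp
  qed
  have skew: "\<exists>\<mu>. \<mu> \<noteq> 0 \<and> k * k = \<iota> \<mu>" if "k \<noteq> 0" "\<sigma> k = - k" for k
  proof -
    have "\<sigma> (k * k) = k * k" using that by simp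
    then obtain \<mu> where "k * k = \<iota> \<mu>" using fixed by blast
    moreover have "k * k \<noteq> 0" using cancel that by simp
    ultimately show ?thesis using \<iota>(4) by metis
  qed
  have regular: "\<exists>y. x = x * x * y" for x :: 'k
  proof (cases "x = 0")
    case False
    then obtain y where "1 = x * y" using unit[of x] by (auto simp: dvd_def)
    then have "x = x * x * y" by (simp add: mult.assoc)
    then show ?thesis by blast
  qed simp
  show ?thesis
  proof
    have "\<sigma> \<theta> - \<theta> \<noteq> 0 \<and> \<sigma> (\<sigma> \<theta> - \<theta>) = - (\<sigma> \<theta> - \<theta>)" using \<theta> \<sigma>\<sigma> by simp
    then show "\<exists>k. k \<noteq> 0 \<and> \<sigma> k = - k" by (rule exI)
    show "unital_ring_hom \<sigma>" using aut by (simp add: ring_aut_def)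
  qed (fact \<iota>_hom \<sigma>\<sigma> fixed skew regular)+
qed

lemma split_etale_conjugation:
  assumes "split_quadratic_algebra \<iota> \<sigma>"
  shows "etale_conjugation (\<iota> :: 'f::field \<Rightarrow> 'k::comm_ring_1) \<sigma>"
proof -
  obtain p q :: "'k \<Rightarrow> 'f" where "unital_ring_hom \<iota>" and p: "unital_ring_hom p"
    and q: "unital_ring_hom q"
    and \<iota>: "p (\<iota> a) = a" "q (\<iota> a) = a" and bij: "bij (\<lambda>x. (p x, q x))"
    and \<sigma>: "p (\<sigma> x) = q x" "q (\<sigma> x) = p x" for a x
    using assms by (auto simp: split_quadratic_algebra_def)
  have eqI: "x = y" if "p x = p y" "q x = q y" for x y
    using that bij by (auto simp: bij_def dest: injD)
  have ex: "\<exists>x. p x = a \<and> q x = b" for a b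
    using bij unfolding bij_def surj_def by (metis prod.inject)
  note [simp] = unital_ring_homD[OF p] unital_ring_homD[OF q]
  show ?thesis
  proof
    show "unital_ring_hom \<iota>" by fact
    show "unital_ring_hom \<sigma>"
      unfolding unital_ring_hom_def by (auto intro!: eqI simp: \<sigma>)
    show "\<sigma> (\<sigma> x) = x" for x by (rule eqI) (simp_all add: \<sigma>)
    show "x \<in> range \<iota>" if "\<sigma> x = x" for x
    proof -
      have "p x = q x" using \<sigma>(1)[of x] that by simp
      then have "x = \<iota> (p x)" by (intro eqI) (simp_all add: \<iota>)
      then show ?thesis by blast
    qed
    obtain k where "p k = 1" "q k = - 1" using ex by blast
    then have "k \<noteq> 0" "\<sigma> k = - k" by (force, intro eqI) (simp_all add: \<sigma>)
    then show "\<exists>k. k \<noteq> 0 \<and> \<sigma> k = - k" by blast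
    show "\<exists>\<mu>. \<mu> \<noteq> 0 \<and> k * k = \<iota> \<mu>" if "k \<noteq> 0" "\<sigma> k = - k" for k
    proof -
      have "q k = - p k" using \<sigma>(1)[of k] that by simp
      moreover from this have "p k \<noteq> 0" using eqI[of k 0] that by auto
      ultimately have "k * k = \<iota> (p k * p k)" "p k * p k \<noteq> 0"
        by (auto intro: eqI simp: \<iota>)
      then show ?thesis by blast
    qed
    show "\<exists>y. x = x * x * y" for x :: 'k
    proof -
      obtain y where "p y = inverse (p x)" "q y = inverse (q x)" using ex by blast
      then have "x = x * x * y" by (intro eqI) (cases "p x = 0"; cases "q x = 0"; simp)+
      then show ?thesis by blast
    qed
  qed
qed

section \<open>Cubic norm structures in which two is invertible\<close>

lemma unit_inv_eq: "unit_inv x = y" if "x * y = 1" for x y :: "'k::comm_ring_1"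
  unfolding unit_inv_def using that
  by (intro the_equality) (auto, metis mult.assoc mult.commute mult.right_neutral)

lemma double_cancel:
  assumes "(2::'k::comm_ring_1) dvd 1"
  shows "2 * x = 2 * y \<longleftrightarrow> x = (y::'k)"
proof -
  obtain h :: 'k where h: "1 = 2 * h" using assms by (auto simp: dvd_def)
  have "z = h * (2 * z)" for z using h by (metis mult.assoc mult.commute mult.left_neutral)
  then show ?thesis by metis
qed

lemma cns_cross_commute: "cns_cross sh a b = cns_cross sh b a"
  by (simp add: cns_cross_def algebra_simps)

context cubic_norm_structure
begin

abbreviation cross (infixl "\<times>\<^sub>J" 70) where "a \<times>\<^sub>J b \<equiv> cns_cross sharp a b"

lemma T_add_left [simp]: "T (a + b) c = T a c + T b c"
  using T_linear[of c] by (simp add: module_hom_iff)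

lemma T_scale_left [simp]: "T (scale t a) c = t * T a c"
  using T_linear[of c] by (simp add: module_hom_iff)

lemma T_add_right [simp]: "T c (a + b) = T c a + T c b"
  by (metis T_add_left T_sym)

lemma T_scale_right [simp]: "T c (scale t a) = t * T c a"
  by (metis T_scale_left T_sym)

lemma T_zero [simp]: "T 0 c = 0" "T c 0 = 0"
  using T_scale_left[of 0 c c] T_scale_right[of c 0 c] by simp_all

lemma T_minus [simp]: "T (- a) c = - T a c" "T c (- a) = - T c a"
  using T_scale_left[of "- 1" a c] T_scale_right[of c "- 1" a] by simp_all

lemma T_diff [simp]: "T (a - b) c = T a c - T b c" "T c (a - b) = T c a - T c b"
  using T_add_left[of a "- b" c] T_add_right[of c a "- b"] by simp_all

lemma sharp_zero [simp]: "sharp 0 = 0"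
  using sharp_scale[of 0 0] by simp

lemma sharp_minus [simp]: "sharp (- a) = sharp a"
  using sharp_scale[of "- 1" a] by simp

lemma N_minus [simp]: "N (- a) = - N a"
  using N_scale[of "- 1" a] by simp

lemma N_zero [simp]: "N 0 = 0"
  using N_scale[of 0 0] by simp

lemma cross_zero [simp]: "0 \<times>\<^sub>J a = 0" "a \<times>\<^sub>J 0 = 0"
  by (simp_all add: cns_cross_def)

lemma cross_scale_self: "a \<times>\<^sub>J scale t a = scale (2 * t) (sharp a)"
proof -
  have "a + scale t a = scale (1 + t) a" by (simp add: scale_left_distrib)
  then have "a \<times>\<^sub>J scale t a = scale ((1 + t)\<^sup>2 - 1 - t\<^sup>2) (sharp a)"
    by (simp add: cns_cross_def sharp_scale scale_left_diff_distrib)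
  also have "(1 + t)\<^sup>2 - 1 - t\<^sup>2 = 2 * t"
    by (simp add: power2_eq_square algebra_simps)
  finally show ?thesis .
qed

text \<open>
  Expanding \<open>N (a + b + c)\<close> by the addition formula with two different bracketings shows that
  \<open>T c (a \<times> b)\<close> is the full polarization of \<open>N\<close>, hence symmetric and additive in every argument.
\<close>

lemma T_cross_rotate: "T c (a \<times>\<^sub>J b) = T a (b \<times>\<^sub>J c)"
proof -
  have "N ((a + b) + c) = N ((b + c) + a)" by (simp add: algebra_simps)
  then show ?thesis
    unfolding N_add cns_cross_def by (simp add: algebra_simps)
qed

lemma T_cross_scale_self:
  "T (scale t a \<times>\<^sub>J scale u b) b = 2 * t * u * T a (sharp b)"
proof -
  have "T (scale t a \<times>\<^sub>J scale u b) b = T (scale t a) (b \<times>\<^sub>J scale u b)"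
    by (metis T_sym T_cross_rotate cns_cross_commute)
  then show ?thesis by (simp add: cross_scale_self)
qed

lemma T_sharp_self:
  assumes "(2::'k) dvd 1"
  shows "T a (sharp a) = 3 * N a"
proof -
  have "a + a = scale 2 a"
    using scale_left_distrib[of 1 1 a] by simp
  then have "N (a + a) = 8 * N a"
    using N_scale[of 2 a] by simp
  then have "2 * T a (sharp a) = 2 * (3 * N a)"
    by (simp add: N_add algebra_simps)
  then show ?thesis using double_cancel[OF assms] by blast
qed

end

section \<open>Self-adjoint autotopies\<close>

text \<open>
  The identity \<open>\<phi>_sharp_\<phi>\<close> replaces the autotopy condition and self-adjointness together:
  \<open>\<phi>(a\<^sup>\<sharp>) = \<delta>\<inverse> U\<^sub>z(\<phi>(a)\<^sup>\<sharp>)\<close> with \<open>U\<^sub>z = \<phi> \<circ> \<phi>\<close> reduces to it because \<open>\<phi>\<close> is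
  injective.
\<close>

locale hermitian_similarity =
  cubic_norm_structure scale N sharp T e + etale_conjugation \<iota> \<sigma>
  for scale :: "'k::comm_ring_1 \<Rightarrow> 'j::ab_group_add \<Rightarrow> 'j"
    and N sharp T e
    and \<iota> :: "'f::field \<Rightarrow> 'k" and \<sigma> +
  fixes \<phi> :: "'j \<Rightarrow> 'j" and \<delta> :: 'k
  assumes two_unit: "(2::'k) dvd 1"
    and \<phi>_semilinear: "semilinear scale \<sigma> \<phi>"
    and \<phi>_bij: "bij \<phi>"
    and \<delta>_unit: "\<delta> dvd 1"
    and \<sigma>_\<delta> [simp]: "\<sigma> \<delta> = \<delta>"
    and \<phi>_sharp_\<phi>: "\<phi> (sharp (\<phi> a)) = scale \<delta> (sharp a)"
begin

lemma \<phi>_add [simp]: "\<phi> (a + b) = \<phi> a + \<phi> b"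
  and \<phi>_scale [simp]: "\<phi> (scale t a) = scale (\<sigma> t) (\<phi> a)"
  using \<phi>_semilinear by (auto simp: semilinear_def)

lemma \<phi>_zero [simp]: "\<phi> 0 = 0"
  using \<phi>_scale[of 0 0] by (simp del: \<phi>_scale)

lemma \<phi>_minus [simp]: "\<phi> (- a) = - \<phi> a"
  using \<phi>_scale[of "- 1" a] by (simp del: \<phi>_scale)

lemma \<phi>_diff [simp]: "\<phi> (a - b) = \<phi> a - \<phi> b"
  using \<phi>_add[of a "- b"] by simp

lemma \<delta>_cancel: "\<delta> * x = \<delta> * y \<Longrightarrow> x = y"
  using \<delta>_unit by (metis dvd_def mult.assoc mult.commute mult.left_neutral)

text \<open>
  Evaluating \<open>\<phi>(\<phi>(a)\<^sup>\<sharp>)\<^sup>\<sharp>\<close> in two ways shows that a scalar \<open>D a\<close>, which is a unit multiple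
  of the difference of the two sides up to \<open>\<sigma>\<close>, annihilates \<open>a\<close>. Over a field this would
  suffice. In general, \<open>D a\<close> and an idempotent \<open>f\<close> generate the same ideal, so
  \<open>a = (1 - f) a\<close>; as \<open>D\<close> is homogeneous of degree three, \<open>D a\<close> is then a multiple of
  \<open>(1 - f) D a = 0\<close>.
\<close>

lemma N_\<phi>: "N (\<phi> a) = \<delta> * \<sigma> (N a)"
proof -
  define D where "D = (\<lambda>a. \<delta> * \<delta> * N a - \<delta> * \<sigma> (N (\<phi> a)))"
  have kill: "scale (D a) a = 0" for a
  proof -
    have "\<phi> (sharp (\<phi> (sharp (\<phi> a)))) = \<phi> (scale (\<delta> * \<sigma> (N (\<phi> a))) a)"
      unfolding \<phi>_sharp_\<phi>[of "sharp (\<phi> a)"] by (simp add: sharp_sharp)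
    then have "sharp (\<phi> (sharp (\<phi> a))) = scale (\<delta> * \<sigma> (N (\<phi> a))) a"
      using \<phi>_bij by (metis bij_pointE)
    moreover have "sharp (\<phi> (sharp (\<phi> a))) = scale (\<delta> * \<delta> * N a) a"
      by (simp add: \<phi>_sharp_\<phi> sharp_scale sharp_sharp power2_eq_square)
    ultimately show ?thesis by (simp add: D_def scale_left_diff_distrib)
  qed
  have D_scale: "D (scale t a) = t ^ 3 * D a" for t a
    by (simp add: D_def N_scale algebra_simps)
  \<comment> \<open>The idempotent is \<open>f = D a * y\<close>.\<close>
  obtain y where y: "D a = D a * D a * y" using regular by blast
  have "a = scale (1 - D a * y) a"
    using kill[of a] by (simp add: scale_left_diff_distrib mult.commute flip: scale_scale)
  then have "D a = (1 - D a * y) ^ 3 * D a"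
    by (metis D_scale)
  also have "\<dots> = (1 - D a * y)\<^sup>2 * (D a - D a * D a * y)"
    by (simp add: power3_eq_cube power2_eq_square algebra_simps)
  finally have "D a = 0" using y by simp
  then have "\<delta> * (\<delta> * N a) = \<delta> * \<sigma> (N (\<phi> a))"
    by (simp add: D_def mult.assoc)
  then have "\<delta> * N a = \<sigma> (N (\<phi> a))" by (rule \<delta>_cancel)
  then show ?thesis by (metis \<sigma>_\<sigma> \<sigma>_\<delta> \<sigma>_simps(3))
qed

text \<open>
  Polarization of \<open>N_\<phi>\<close>. Evaluating \<open>N\<close> at both \<open>b + a\<close> and \<open>b - a\<close> isolates the part of
  \<open>N (b + a)\<close> that is quadratic in \<open>a\<close>.
\<close>

lemma T_\<phi>_sharp_\<phi>: "T (\<phi> b) (sharp (\<phi> a)) = \<delta> * \<sigma> (T b (sharp a))"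
proof -
  have polar: "2 * T b (sharp a) = N (b + a) + N (b - a) - 2 * N b" for a b
    using N_add[of b a] N_add[of b "- a"] by (simp add: algebra_simps)
  have "2 * T (\<phi> b) (sharp (\<phi> a)) = N (\<phi> (b + a)) + N (\<phi> (b - a)) - 2 * N (\<phi> b)"
    by (simp add: polar)
  also have "\<dots> = \<delta> * \<sigma> (2 * T b (sharp a))"
    unfolding N_\<phi> polar by (simp add: algebra_simps)
  also have "\<dots> = 2 * (\<delta> * \<sigma> (T b (sharp a)))"
    by (simp add: algebra_simps)
  finally show ?thesis using double_cancel[OF two_unit] by blast
qed

text \<open>
  The case \<open>c = \<phi>(a)\<^sup>\<sharp>\<close> is \<open>T_\<phi>_sharp_\<phi>\<close> combined with \<open>\<phi>_sharp_\<phi>\<close>. As \<open>\<phi>\<close> is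
  onto, this covers all elements \<open>c\<^sup>\<sharp>\<close>, in particular \<open>e = e\<^sup>\<sharp>\<close>. They span \<open>J\<close>, since
  \<open>c = T(c, e) e - e \<times> c\<close> and \<open>e \<times> c\<close> is a combination of three of them.
\<close>

lemma T_\<phi>_hermitian: "T (\<phi> b) c = \<sigma> (T b (\<phi> c))"
proof -
  have sharp: "T (\<phi> b) (sharp c) = \<sigma> (T b (\<phi> (sharp c)))" for c
  proof -
    obtain a where "c = \<phi> a" using \<phi>_bij by (metis bij_pointE)
    then show ?thesis by (simp add: T_\<phi>_sharp_\<phi> \<phi>_sharp_\<phi>)
  qed
  have e: "T (\<phi> b) e = \<sigma> (T b (\<phi> e))" using sharp[of e] by (simp add: sharp_e)
  have "T (\<phi> b) (scale (T c e) e - e \<times>\<^sub>J c) = \<sigma> (T b (\<phi> (scale (T c e) e - e \<times>\<^sub>J c)))"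
    by (simp add: e sharp cns_cross_def)
  then show ?thesis by (simp flip: e_cross)
qed

lemma \<sigma>_T_\<phi>_self [simp]: "\<sigma> (T b (\<phi> b)) = T b (\<phi> b)"
  using T_\<phi>_hermitian[of b b] by (simp add: T_sym)

text \<open>
  Up to the factor \<open>\<delta>\<close>, this is a diagonal value \<open>T(c, \<phi> c)\<close> of the hermitian form, with
  \<open>c = \<phi>(b)\<^sup>\<sharp>\<close>.
\<close>

lemma \<sigma>_T_sharp_sharp [simp]:
  "\<sigma> (T (sharp b) (sharp (\<phi> b))) = T (sharp b) (sharp (\<phi> b))"
proof (rule \<delta>_cancel)
  have "\<delta> * T (sharp b) (sharp (\<phi> b)) = T (sharp (\<phi> b)) (\<phi> (sharp (\<phi> b)))"
    by (simp add: \<phi>_sharp_\<phi> T_sym)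
  then have "\<sigma> (\<delta> * T (sharp b) (sharp (\<phi> b))) = \<delta> * T (sharp b) (sharp (\<phi> b))"
    by (simp only: \<sigma>_T_\<phi>_self)
  then show "\<delta> * \<sigma> (T (sharp b) (sharp (\<phi> b))) = \<delta> * T (sharp b) (sharp (\<phi> b))"
    by simp
qed

end

section \<open>The norm\<close>

locale hermitian_algebra = hermitian_similarity scale N sharp T e \<iota> \<sigma> \<phi> \<delta>
  for scale :: "'k::comm_ring_1 \<Rightarrow> 'j::ab_group_add \<Rightarrow> 'j"
    and N sharp T e
    and \<iota> :: "'f::field \<Rightarrow> 'k" and \<sigma> \<phi> \<delta> +
  fixes \<gamma> :: 'k
  assumes \<gamma>_norm: "\<sigma> \<gamma> * \<gamma> * \<delta> = 1"
begin

abbreviation mul (infixl "\<odot>" 70) where "x \<odot> y \<equiv> KJ_mul \<sigma> scale sharp T \<phi> \<gamma> x y"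
abbreviation bar :: "'k \<times> 'j \<Rightarrow> 'k \<times> 'j" where "bar \<equiv> KJ_bar \<sigma>"
abbreviation smul where "smul \<equiv> KJ_smul \<iota> scale"

lemma unit_inv_\<gamma>: "unit_inv \<gamma> = \<sigma> \<gamma> * \<delta>"
  using \<gamma>_norm by (intro unit_inv_eq) (simp add: ac_simps)

definition quartic where
  "quartic s b = (Nr \<sigma> s - T b (\<phi> b))\<^sup>2 - 4 * T (sharp b) (sharp (\<phi> b))
     + 4 * Tr \<sigma> (unit_inv \<gamma> * s * N b)"

text \<open>
  The components in \<open>J\<close> of \<open>x * bar y\<close> and \<open>y * bar x\<close> agree because \<open>\<times>\<close> is symmetric; in \<open>K\<close>,
  hermitian symmetry makes the value a difference of conjugates.
\<close>

lemma psi_eq: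
  "str_psi mul bar (s, b) y =
     (\<sigma> (fst y * \<sigma> s + T (snd y) (\<phi> b)) - (fst y * \<sigma> s + T (snd y) (\<phi> b)), 0)"
proof (cases y)
  case (Pair t c)
  have "T b (\<phi> c) = \<sigma> (T c (\<phi> b))" by (metis T_\<phi>_hermitian T_sym)
  then show ?thesis
    by (simp add: Pair str_psi_def KJ_mul_def KJ_bar_def cns_cross_commute algebra_simps)
qed

text \<open>
  The main computation. In it \<open>P\<close> and \<open>Q\<close> are, up to scalars, the components in \<open>J\<close> of
  \<open>x * bar (k x)\<close> and \<open>x * bar x\<close>. The cross products that remain in \<open>U\<^sub>x(k x)\<close> are paired
  with \<open>\<phi> b\<close>, which turns them into \<open>T(\<phi> P, \<phi>(b)\<^sup>\<sharp>)\<close> and \<open>T(\<phi> Q, \<phi>(b)\<^sup>\<sharp>)\<close>, and these are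
  known from \<open>T_\<phi>_sharp_\<phi>\<close>.
\<close>

lemma psi_arg:
  assumes "\<sigma> k = - k"
    and y_def: "y = str_U smul mul bar (s, b) ((k, 0) \<odot> (s, b))"
  shows "fst y * \<sigma> s + T (snd y) (\<phi> b) =
    - (3 * k * ((Nr \<sigma> s - T b (\<phi> b))\<^sup>2 - 4 * T (sharp b) (sharp (\<phi> b))
       + 8 * \<sigma> (unit_inv \<gamma> * s * N b)))"
proof -
  \<comment> \<open>As \<open>\<gamma>\<inverse> = \<sigma> \<gamma> * \<delta>\<close>, this \<open>M\<close> is the conjugate of \<open>\<gamma>\<inverse> * s * N b\<close>.\<close>
  define n \<tau> \<omega> M where "n = s * \<sigma> s" and "\<tau> = T b (\<phi> b)"
    and "\<omega> = T (sharp b) (sharp (\<phi> b))" and "M = \<gamma> * \<delta> * \<sigma> s * \<sigma> (N b)"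
  define P Q where "P = scale s b - scale \<gamma> (sharp (\<phi> b))"
    and "Q = scale s b + scale \<gamma> (sharp (\<phi> b))"
  have k: "(k, 0) \<odot> (s, b) = (k * s, scale k b)"
    by (simp add: KJ_mul_def)
  have double: "scale (t * 2) b = scale t b + scale t b" for t
    by (simp add: mult.commute mult_2 flip: scale_left_distrib)
  have double': "scale (k * (s * 2)) b = scale (k * s) b + scale (k * s) b"
    using double[of "k * s"] by (simp add: mult.assoc)
  have mul1: "(s, b) \<odot> bar (k * s, scale k b) = (- k * (n + \<tau>), scale (2 * k) P)"
    using cross_scale_self[of "\<phi> b" "- k"]
    by (simp add: KJ_mul_def KJ_bar_def assms(1) P_def n_def \<tau>_def algebra_simps double')
  have mul2: "(s, b) \<odot> bar (s, b) = (n + \<tau>, scale 2 Q)"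
    using cross_scale_self[of "\<phi> b" 1]
    by (simp add: KJ_mul_def KJ_bar_def Q_def n_def \<tau>_def
          algebra_simps double)
  have \<sigma>\<tau>: "\<sigma> \<tau> = \<tau>" and \<sigma>\<omega>: "\<sigma> \<omega> = \<omega>" by (simp_all add: \<tau>_def \<omega>_def)
  have N\<phi>: "T (sharp (\<phi> b)) (\<phi> b) = 3 * (\<delta> * \<sigma> (N b))"
    using T_sharp_self[OF two_unit, of "\<phi> b"] by (simp add: N_\<phi> T_sym)
  have Nb: "T b (sharp b) = 3 * N b" by (rule T_sharp_self[OF two_unit])
  have TP: "T P (\<phi> b) = s * \<tau> - 3 * \<gamma> * \<delta> * \<sigma> (N b)"
    and TQ: "T Q (\<phi> b) = s * \<tau> + 3 * \<gamma> * \<delta> * \<sigma> (N b)"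
    by (simp_all add: P_def Q_def \<tau>_def N\<phi> algebra_simps)
  have TP': "T (\<phi> P) (sharp (\<phi> b)) = \<delta> * \<sigma> (3 * s * N b - \<gamma> * \<omega>)"
    and TQ': "T (\<phi> Q) (sharp (\<phi> b)) = \<delta> * \<sigma> (3 * s * N b + \<gamma> * \<omega>)"
    unfolding T_\<phi>_sharp_\<phi> by (simp_all add: P_def Q_def Nb \<omega>_def T_sym algebra_simps)
  have \<gamma>TP': "\<gamma> * T (\<phi> P) (sharp (\<phi> b)) = 3 * M - \<omega>"
    using arg_cong[OF \<gamma>_norm, of "\<lambda>x. x * \<omega>"] by (simp add: TP' \<sigma>\<omega> M_def algebra_simps)
  have \<gamma>TQ': "\<gamma> * T (\<phi> Q) (sharp (\<phi> b)) = 3 * M + \<omega>"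
    using arg_cong[OF \<gamma>_norm, of "\<lambda>x. x * \<omega>"] by (simp add: TQ' \<sigma>\<omega> M_def algebra_simps)
  have crossP: "T (scale (- (2 * k)) (\<phi> P) \<times>\<^sub>J \<phi> b) (\<phi> b) =
      - (4 * k * T (\<phi> P) (sharp (\<phi> b)))"
    using T_cross_scale_self[of "- (2 * k)" "\<phi> P" 1 "\<phi> b"] by simp
  have crossQ: "T (scale 2 (\<phi> Q) \<times>\<^sub>J scale (- k) (\<phi> b)) (\<phi> b) =
      - (4 * k * T (\<phi> Q) (sharp (\<phi> b)))"
    using T_cross_scale_self[of 2 "\<phi> Q" "- k" "\<phi> b"] by simp
  have y1: "fst y = 2 * (- k * (n + \<tau>) * s + 2 * k * T P (\<phi> b))
      - ((n + \<tau>) * (k * s) - 2 * k * T Q (\<phi> b))"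
    unfolding y_def k str_U_def mul1 mul2
    by (simp add: KJ_mul_def KJ_smul_def assms(1) algebra_simps)
  have y2: "snd y = scale 2 (scale (- k * (n + \<tau>)) b + scale (\<sigma> s) (scale (2 * k) P)
        + scale \<gamma> (scale (- (2 * k)) (\<phi> P) \<times>\<^sub>J \<phi> b))
      - (scale (n + \<tau>) (scale k b) + scale (- k * \<sigma> s) (scale 2 Q)
        + scale \<gamma> (scale 2 (\<phi> Q) \<times>\<^sub>J scale (- k) (\<phi> b)))"
    unfolding y_def k str_U_def mul1 mul2
    by (simp add: KJ_mul_def KJ_smul_def assms(1))
  have "T (snd y) (\<phi> b) = 2 * (- k * (n + \<tau>) * \<tau> + \<sigma> s * (2 * k * T P (\<phi> b))
        - 4 * k * (\<gamma> * T (\<phi> P) (sharp (\<phi> b))))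
      - ((n + \<tau>) * (k * \<tau>) - k * \<sigma> s * (2 * T Q (\<phi> b))
        - 4 * k * (\<gamma> * T (\<phi> Q) (sharp (\<phi> b))))"
    unfolding y2 T_diff T_add_left T_scale_left crossP crossQ \<tau>_def[symmetric]
    by (simp add: algebra_simps)
  also have "\<dots> = k * (3 * n * \<tau> - 3 * \<tau> * \<tau> - 18 * M + 12 * \<omega>)"
    unfolding TP TQ \<gamma>TP' \<gamma>TQ' by (simp add: n_def M_def algebra_simps)
  finally have Ty2: "T (snd y) (\<phi> b) = k * (3 * n * \<tau> - 3 * \<tau> * \<tau> - 18 * M + 12 * \<omega>)" .
  have y1': "fst y * \<sigma> s = k * (- 3 * n * n + 3 * \<tau> * n - 6 * M)"
    unfolding y1 TP TQ by (simp add: n_def M_def algebra_simps)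
  have M: "\<sigma> (unit_inv \<gamma> * s * N b) = M" and n: "Nr \<sigma> s = n"
    by (simp_all add: unit_inv_\<gamma> M_def Nr_def n_def)
  have "fst y * \<sigma> s + T (snd y) (\<phi> b) = - (3 * k * ((n - \<tau>)\<^sup>2 - 4 * \<omega> + 8 * M))"
    unfolding y1' Ty2 by (simp add: power2_eq_square algebra_simps)
  then show ?thesis
    unfolding M n \<tau>_def \<omega>_def .
qed

lemma \<sigma>_quartic: "\<sigma> (quartic s b) = quartic s b"
  by (simp add: quartic_def Nr_def Tr_def ac_simps)

lemma psi_U_eq_quartic:
  assumes "\<sigma> k = - k"
  shows "str_psi mul bar (s, b) (str_U smul mul bar (s, b) ((k, 0) \<odot> (s, b))) \<odot> (k, 0) =
    (6 * (k * k) * quartic s b, 0)"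
proof -
  define X where "X = (Nr \<sigma> s - T b (\<phi> b))\<^sup>2 - 4 * T (sharp b) (sharp (\<phi> b))"
  define m where "m = unit_inv \<gamma> * s * N b"
  have \<sigma>X: "\<sigma> X = X" by (simp add: X_def Nr_def mult.commute)
  have "(\<sigma> (- (3 * k * (X + 8 * \<sigma> m))) - (- (3 * k * (X + 8 * \<sigma> m)))) * k
      = 6 * (k * k) * (X + 4 * Tr \<sigma> m)"
    by (simp add: assms \<sigma>X Tr_def algebra_simps)
  then show ?thesis
    unfolding psi_eq psi_arg[OF assms refl] quartic_def X_def[symmetric] m_def[symmetric]
    by (simp add: KJ_mul_def)
qed

text \<open>
  A skew element has no component in \<open>J\<close>: it would equal its own negative, and two is
  invertible.
\<close>

lemma skew_iff:
  "z \<noteq> 0 \<and> bar z = - z \<longleftrightarrow> (\<exists>k. z = (k, 0) \<and> k \<noteq> 0 \<and> \<sigma> k = - k)"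
proof -
  have "c = 0" if "c = - c" for c :: 'j
  proof -
    obtain h :: 'k where h: "1 = 2 * h" using two_unit by (auto simp: dvd_def)
    have "c + c = 0" using that by (metis eq_neg_iff_add_eq_0)
    then have "scale 2 c = 0" using scale_left_distrib[of 1 1 c] by simp
    then have "scale (h * 2) c = 0" by (simp flip: scale_scale)
    with h show ?thesis by (simp add: mult.commute)
  qed
  then show ?thesis by (cases z) (auto simp: KJ_bar_def zero_prod_def)
qed

text \<open>
  The quartic form is fixed by \<open>\<sigma>\<close>, so it has the form \<open>\<iota> v\<close>, and \<open>v\<close> satisfies the condition
  that defines the norm for every skew element. Conversely, a single non-zero skew element
  determines \<open>v\<close>, because \<open>\<iota>\<close> is injective.
\<close>

lemma structurable_norm_eq_quartic:
  assumes six: "(6::'f) \<noteq> 0"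
  shows "\<iota> (structurable_norm smul (1, 0) mul bar (s, b)) = quartic s b"
proof -
  obtain v where v: "quartic s b = \<iota> v"
    using fixed_in_range[OF \<sigma>_quartic] by blast
  have smul_one: "smul w (1, 0) = (\<iota> w, 0)" for w
    by (simp add: KJ_smul_def)
  have normalized: "smul (1 / (6 * \<mu>))
      (str_psi mul bar (s, b) (str_U smul mul bar (s, b) ((k, 0) \<odot> (s, b))) \<odot> (k, 0))
      = smul v (1, 0)"
    if "\<sigma> k = - k" "\<mu> \<noteq> 0" "k * k = \<iota> \<mu>" for k \<mu>
  proof -
    have scalars: "smul a (\<iota> x, 0) = (\<iota> (a * x), 0)" for a x
      by (simp add: KJ_smul_def)
    have six_\<mu>: "6 * \<iota> \<mu> * \<iota> v = \<iota> (6 * \<mu> * v)" by simp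
    have "smul (1 / (6 * \<mu>))
      (str_psi mul bar (s, b) (str_U smul mul bar (s, b) ((k, 0) \<odot> (s, b))) \<odot> (k, 0))
      = (\<iota> (1 / (6 * \<mu>) * (6 * \<mu> * v)), 0)"
      unfolding psi_U_eq_quartic[OF that(1)] v that(3) six_\<mu> scalars ..
    also have "1 / (6 * \<mu>) * (6 * \<mu> * v) = v" using six that(2) by simp
    finally show ?thesis by (simp add: smul_one)
  qed
  have square: "(k, 0) \<odot> (k, 0) = (k * k, 0)" for k
    by (simp add: KJ_mul_def)
  have "structurable_norm smul (1, 0) mul bar (s, b) = v"
    unfolding structurable_norm_def skew_iff
  proof (rule the_equality)
    show "\<forall>z. (\<exists>k. z = (k, 0) \<and> k \<noteq> 0 \<and> \<sigma> k = - k) \<longrightarrow>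
      (\<exists>\<mu>. \<mu> \<noteq> 0 \<and> z \<odot> z = smul \<mu> (1, 0) \<and> smul v (1, 0) =
        smul (1 / (6 * \<mu>)) (str_psi mul bar (s, b) (str_U smul mul bar (s, b) (z \<odot> (s, b))) \<odot> z))"
    proof (intro allI impI, elim exE conjE)
      fix z :: "'k \<times> 'j" and k
      assume z: "z = (k, 0)" and k: "k \<noteq> 0" "\<sigma> k = - k"
      obtain \<mu> where \<mu>: "\<mu> \<noteq> 0" "k * k = \<iota> \<mu>" using skew_square k by blast
      show "\<exists>\<mu>. \<mu> \<noteq> 0 \<and> z \<odot> z = smul \<mu> (1, 0) \<and> smul v (1, 0) =
        smul (1 / (6 * \<mu>)) (str_psi mul bar (s, b) (str_U smul mul bar (s, b) (z \<odot> (s, b))) \<odot> z)"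
        using normalized[OF k(2) \<mu>] \<mu> by (intro exI[of _ \<mu>]) (simp add: z square smul_one)
    qed
  next
    fix w
    assume w: "\<forall>z. (\<exists>k. z = (k, 0) \<and> k \<noteq> 0 \<and> \<sigma> k = - k) \<longrightarrow>
      (\<exists>\<mu>. \<mu> \<noteq> 0 \<and> z \<odot> z = smul \<mu> (1, 0) \<and> smul w (1, 0) =
        smul (1 / (6 * \<mu>)) (str_psi mul bar (s, b) (str_U smul mul bar (s, b) (z \<odot> (s, b))) \<odot> z))"
    obtain k where k: "k \<noteq> 0" "\<sigma> k = - k" using skew_exists by blast
    with w obtain \<mu> where \<mu>: "\<mu> \<noteq> 0" "(k, 0) \<odot> (k, 0) = smul \<mu> (1, 0)"
      "smul w (1, 0) = smul (1 / (6 * \<mu>))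
        (str_psi mul bar (s, b) (str_U smul mul bar (s, b) ((k, 0) \<odot> (s, b))) \<odot> (k, 0))"
      by blast
    from \<mu>(2) have "k * k = \<iota> \<mu>" by (simp add: square smul_one)
    with normalized[OF k(2) \<mu>(1)] \<mu>(3) have "smul w (1, 0) = smul v (1, 0)" by simp
    then show "w = v" by (simp add: smul_one \<iota>_inj)
  qed
  then show ?thesis by (simp add: v)
qed

end

theorem proposition3p12:
  fixes \<iota> :: "'f::field \<Rightarrow> 'k::comm_ring_1"
    and \<sigma> :: "'k \<Rightarrow> 'k"
    and scale :: "'k \<Rightarrow> 'j::ab_group_add \<Rightarrow> 'j"
    and N :: "'j \<Rightarrow> 'k"
    and sharp :: "'j \<Rightarrow> 'j"
    and T :: "'j \<Rightarrow> 'j \<Rightarrow> 'k"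
    and e :: 'j
    and \<phi> :: "'j \<Rightarrow> 'j"
    and \<delta> \<gamma> s :: 'k
    and b :: 'j
  assumes "CHAR('f) \<noteq> 2" and "CHAR('f) \<noteq> 3"
    and "quadratic_etale \<iota> \<sigma>"
    and "cubic_norm_structure scale N sharp T e"
    and "\<phi> \<in> Str scale N sharp T e"
    and "semilinear scale \<sigma> \<phi>"
    and "adjoint_autotopy scale sharp T e \<phi> = \<phi>"
    and "\<delta> = N (\<phi> e)"
    and "\<sigma> \<gamma> * \<gamma> = unit_inv \<delta>"
  shows "\<iota> (structurable_norm (KJ_smul \<iota> scale) (1, 0)
              (KJ_mul \<sigma> scale sharp T \<phi> \<gamma>) (KJ_bar \<sigma>) (s, b)) =
         (Nr \<sigma> s - T b (\<phi> b)) ^ 2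
           - 4 * T (sharp b) (sharp (\<phi> b))
           + 4 * Tr \<sigma> (unit_inv \<gamma> * s * N b)"
proof -
  interpret etale_conjugation \<iota> \<sigma>
    using assms(3) field_ext_etale_conjugation split_etale_conjugation
    by (auto simp: quadratic_etale_def)
  interpret cubic_norm_structure scale N sharp T e by fact
  have two: "(2::'f) \<noteq> 0" and three: "(3::'f) \<noteq> 0"
  proof -
    have "p \<noteq> CHAR('f) \<Longrightarrow> prime p \<Longrightarrow> of_nat p \<noteq> (0::'f)" for p
      using CHAR_not_1[where ?'a = 'f]
      by (auto simp: of_nat_eq_0_iff_char_dvd prime_nat_iff)
    from this[of 2] this[of 3] assms(1,2) show "(2::'f) \<noteq> 0" "(3::'f) \<noteq> 0"
      by simp_all
  qed
  have bij: "bij \<phi>" and \<delta>_unit: "\<delta> dvd 1"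
    and autotopy: "\<phi> (sharp a) = scale (unit_inv \<delta>) (cns_U scale sharp T (\<phi> e) (sharp (\<phi> a)))" for a
    using assms(5,8) by (auto simp: Str_def isotope_sharp_def)
  obtain \<delta>' where \<delta>': "\<delta> * \<delta>' = 1" using \<delta>_unit by (auto simp: dvd_def)
  then have inv_\<delta>: "unit_inv \<delta> = \<delta>'" by (rule unit_inv_eq)
  have norm: "\<sigma> \<gamma> * \<gamma> * \<delta> = 1" using \<delta>' inv_\<delta> assms(9) by (simp add: mult.commute)
  \<comment> \<open>The norm \<open>\<sigma> \<gamma> * \<gamma>\<close> is fixed by \<open>\<sigma>\<close>, and therefore so is \<open>\<delta>\<close>.\<close>
  have \<sigma>\<delta>': "\<sigma> \<delta>' = \<delta>'" using arg_cong[OF assms(9), of \<sigma>] assms(9) inv_\<delta> by (simp add: mult.commute)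
  have \<sigma>\<delta>: "\<sigma> \<delta> = \<delta>"
  proof -
    have "\<sigma> \<delta> * \<delta>' = 1" using arg_cong[OF \<delta>', of \<sigma>] \<sigma>\<delta>' by simp
    then show ?thesis using \<delta>' by (metis mult.assoc mult.commute mult.left_neutral)
  qed
  have U: "cns_U scale sharp T (\<phi> e) c = \<phi> (\<phi> c)" for c
  proof -
    have "inv \<phi> (cns_U scale sharp T (\<phi> e) c) = \<phi> c"
      using fun_cong[OF assms(7), of c] by (simp add: adjoint_autotopy_def)
    then show ?thesis using bij by (metis bij_inv_eq_iff)
  qed
  have \<phi>_scale: "\<phi> (scale t a) = scale (\<sigma> t) (\<phi> a)" for t a
    using assms(6) by (simp add: semilinear_def)
  have key: "\<phi> (sharp (\<phi> a)) = scale \<delta> (sharp a)" for a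
  proof -
    have "\<phi> (sharp a) = \<phi> (scale \<delta>' (\<phi> (sharp (\<phi> a))))"
      using autotopy[of a] by (simp add: U inv_\<delta> \<phi>_scale \<sigma>\<delta>')
    then have "sharp a = scale \<delta>' (\<phi> (sharp (\<phi> a)))"
      using bij by (metis bij_pointE)
    then show ?thesis using \<delta>' by simp
  qed
  have two_unit: "(2::'k) dvd 1"
  proof -
    have "\<iota> (2 * inverse 2) = 1" using two by simp
    then have "1 = 2 * \<iota> (inverse 2)" by (simp only: \<iota>_simps \<iota>_numeral)
    then show ?thesis by (rule dvdI)
  qed
  interpret hermitian_algebra scale N sharp T e \<iota> \<sigma> \<phi> \<delta> \<gamma>
    using two_unit assms(6) bij \<delta>_unit \<sigma>\<delta> key norm by unfold_locales
  have "(6::'f) = 2 * 3" by simp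
  then have "(6::'f) \<noteq> 0" using two three by (metis mult_eq_0_iff)
  then show ?thesis
    using structurable_norm_eq_quartic[of s b] by (simp add: quartic_def)
qed

end
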